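(* Let $G$ be a finite group and let $M$ be a faithful $\mathbb{Q}G$-module of dimension $n$ over $\mathbb{Q}$. Then there exist an integer $r\ge 0$ and a realizable family $\mathcal{Q}=\{q_0,\ldots,q_{r+1}\}$ of $n$-algebraic forms over $M$ such that $\deg(q_0)=2$ and $G$, regarded as a subgroup of $\mathrm{GL}(M)$ via its action on $M$, is equal to the orthogonal group $\mathrm{O}(\mathcal{Q})\leq \mathrm{GL}(M)$.
   Context: Here $n\ge 1$. $\mathbb{Q}[M]$ denotes the ring of polynomial functions on $M$; choosing a basis $\{v_1,\ldots,v_n\}$ of the dual $M^\ast$, it is the polynomial ring $\mathbb{Q}[v_1,\ldots,v_n]$. An $n$-algebraic form of degree $d$ over $M$ is a homogeneous polynomial function $q(v_1,\ldots,v_n)\in\mathbb{Q}[M]$ of degree $d$. For a family $\mathcal{Q}=\{q_0,\ldots,q_m\}$ of $n$-algebraic forms, the orthogonal group is $\mathrm{O}(\mathcal{Q})=\{f\in\mathrm{GL}(M)\mid q_i\circ f=q_i \text{ for every } i=0,\ldots,m\}$. A family of $n$-algebraic forms $\mathcal{Q}=\{q_0,\ldots,q_{r+1}\}\subset\mathbb{Q}[M]$ is realizable if: (1) $q_{r+1}=q_0^s$ for some $s\geq \max\{n,\lceil \deg(q_r)/\deg(q_0)\rceil+1\}$; (2) $\deg(q_{i+1})-\deg(q_i)>1$ for $i=0,\ldots,r$; (3) for some basis $\{v_1,\ldots,v_n\}$ of $M^\ast$, $q_0=\lambda_1v_1^d+\cdots+\lambda_nv_n^d$ for some integer $d>1$,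 with $\lambda_i\in\mathbb{Q}$, $\lambda_i\neq 0$ for $i=1,\ldots,n$. *)

theory Defs
  imports
    "HOL-Library.Function_Algebras"
    "HOL-Algebra.Group"
    Complex_Main
begin

text \<open>
  The rational vector space \<open>M\<close> is a type \<open>'v\<close> of class \<open>ab_group_add\<close> with a scalar
  multiplication \<open>scale\<close> satisfying the library predicate \<open>vector_space scale\<close>; its dimension
  is \<open>vector_space.dim scale UNIV\<close>. Polynomial functions on \<open>M\<close> are functions \<open>'v \<Rightarrow> rat\<close>;
  the field being infinite, polynomials in a basis of the dual space may be identified with
  the functions they induce.
\<close>

subsection \<open>The general linear group and modules over the group algebra\<close>

definition GL :: "(rat \<Rightarrow> 'v \<Rightarrow> 'v) \<Rightarrow> ('v::ab_group_add \<Rightarrow> 'v) monoid" where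
  "GL scale = \<lparr>carrier = {f. Vector_Spaces.linear scale scale f \<and> bij f},
               monoid.mult = (\<circ>), one = id\<rparr>"

text \<open>A module over the rational group algebra of \<open>G\<close>, with underlying vector space \<open>M\<close>, is
  given by its structure map from \<open>G\<close> to \<open>GL(M)\<close>.\<close>

definition faithful_module ::
    "('g, 'b) monoid_scheme \<Rightarrow> (rat \<Rightarrow> 'v::ab_group_add \<Rightarrow> 'v) \<Rightarrow> ('g \<Rightarrow> 'v \<Rightarrow> 'v) \<Rightarrow> bool" where
  "faithful_module G scale \<phi> \<longleftrightarrow> \<phi> \<in> hom G (GL scale) \<and> inj_on \<phi> (carrier G)"

subsection \<open>The dual space\<close>

definition fun_scale :: "rat \<Rightarrow> ('v \<Rightarrow> rat) \<Rightarrow> 'v \<Rightarrow> rat" where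
  "fun_scale c f = (\<lambda>x. c * f x)"

interpretation fun_space: vector_space "fun_scale :: rat \<Rightarrow> ('v \<Rightarrow> rat) \<Rightarrow> 'v \<Rightarrow> rat"
  by unfold_locales (auto simp: fun_scale_def fun_eq_iff algebra_simps)

definition dual_space :: "(rat \<Rightarrow> 'v::ab_group_add \<Rightarrow> 'v) \<Rightarrow> ('v \<Rightarrow> rat) set" where
  "dual_space scale = {f. Vector_Spaces.linear scale (*) f}"

text \<open>The basis is the family \<open>v 0, \<dots>, v (n - 1)\<close>; further values of \<open>v\<close> are irrelevant.\<close>

definition dual_basis ::
    "(rat \<Rightarrow> 'v::ab_group_add \<Rightarrow> 'v) \<Rightarrow> nat \<Rightarrow> (nat \<Rightarrow> 'v \<Rightarrow> rat) \<Rightarrow> bool" where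
  "dual_basis scale n v \<longleftrightarrow>
     inj_on v {..<n} \<and> fun_space.independent (v ` {..<n}) \<and>
     fun_space.span (v ` {..<n}) = dual_space scale"

subsection \<open>Algebraic forms\<close>

definition exponents :: "nat \<Rightarrow> nat \<Rightarrow> (nat \<Rightarrow> nat) set" where
  "exponents n d = {\<alpha>. (\<forall>i\<ge>n. \<alpha> i = 0) \<and> (\<Sum>i<n. \<alpha> i) = d}"

lemma finite_exponents: "finite (exponents n d)"
proof (rule finite_subset)
  show "exponents n d \<subseteq> {\<alpha>. \<forall>i. (i \<in> {..<n} \<longrightarrow> \<alpha> i \<in> {..d}) \<and> (i \<notin> {..<n} \<longrightarrow> \<alpha> i = 0)}"
    by (auto simp: exponents_def intro: member_le_sum)
  show "finite {\<alpha>. \<forall>i. (i \<in> {..<n} \<longrightarrow> \<alpha> i \<in> {..d}) \<and> (i \<notin> {..<n} \<longrightarrow> \<alpha> i = (0::nat))}"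
    by (rule finite_set_of_finite_funs) auto
qed

text \<open>A homogeneous polynomial of degree \<open>d\<close> in \<open>v 0, \<dots>, v (n - 1)\<close> with coefficients \<open>c\<close>,
  where \<open>n\<close> is the dimension of \<open>M\<close>. The notion does not depend on the basis. The zero function
  is a form of every degree.\<close>

definition algebraic_form ::
    "(rat \<Rightarrow> 'v::ab_group_add \<Rightarrow> 'v) \<Rightarrow> nat \<Rightarrow> ('v \<Rightarrow> rat) \<Rightarrow> bool" where
  "algebraic_form scale d q \<longleftrightarrow>
     (let n = vector_space.dim scale UNIV in
      \<exists>v. dual_basis scale n v \<and>
        (\<exists>c. q = (\<lambda>x. \<Sum>\<alpha>\<in>exponents n d. c \<alpha> * (\<Prod>i<n. v i x ^ \<alpha> i))))"

text \<open>For a nonzero form the degree is unique, see below; the zero form gets degree 0.\<close>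

definition form_degree :: "(rat \<Rightarrow> 'v::ab_group_add \<Rightarrow> 'v) \<Rightarrow> ('v \<Rightarrow> rat) \<Rightarrow> nat" where
  "form_degree scale q = (LEAST d. algebraic_form scale d q)"

lemma algebraic_form_homogeneous:
  assumes "algebraic_form scale d q"
  shows "q (scale t x) = t ^ d * q x"
proof -
  define n where "n = vector_space.dim scale UNIV"
  obtain v c where v: "dual_basis scale n v"
    and q: "q = (\<lambda>x. \<Sum>\<alpha>\<in>exponents n d. c \<alpha> * (\<Prod>i<n. v i x ^ \<alpha> i))"
    using assms by (auto simp: algebraic_form_def n_def Let_def)
  have lin: "v i (scale t x) = t * v i x" if "i < n" for i
  proof -
    have "v i \<in> dual_space scale"
      using v that fun_space.span_base[of "v i" "v ` {..<n}"] by (auto simp: dual_basis_def)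
    then have "Vector_Spaces.linear scale (*) (v i)" by (simp add: dual_space_def)
    then show ?thesis by (simp add: Vector_Spaces.linear_iff)
  qed
  have "(\<Prod>i<n. v i (scale t x) ^ \<alpha> i) = t ^ d * (\<Prod>i<n. v i x ^ \<alpha> i)"
    if "\<alpha> \<in> exponents n d" for \<alpha>
    using that by (simp add: lin power_mult_distrib prod.distrib exponents_def flip: power_sum)
  then show ?thesis
    by (simp add: q sum_distrib_left mult_ac)
qed

lemma form_degree_eq:
  assumes "algebraic_form scale d q" "q x \<noteq> 0"
  shows "form_degree scale q = d"
  unfolding form_degree_def
proof (rule Least_equality)
  show "d \<le> e" if "algebraic_form scale e q" for e
    using algebraic_form_homogeneous[OF assms(1), of 2 x] algebraic_form_homogeneous[OF that, of 2 x]
      assms(2) by simp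
qed (fact assms)

subsection \<open>Realizable families and their orthogonal groups\<close>

definition orthogonal_group ::
    "(rat \<Rightarrow> 'v::ab_group_add \<Rightarrow> 'v) \<Rightarrow> ('v \<Rightarrow> rat) set \<Rightarrow> ('v \<Rightarrow> 'v) set" where
  "orthogonal_group scale Q = {f \<in> carrier (GL scale). \<forall>p\<in>Q. p \<circ> f = p}"

text \<open>The family is \<open>q 0, \<dots>, q (r + 1)\<close>; further values of \<open>q\<close> are irrelevant. The gaps between
  consecutive degrees force \<open>q 1, \<dots>, q (r + 1)\<close> to be nonzero, the zero form having degree 0;
  \<open>q 0\<close> is nonzero by its diagonal shape when \<open>n > 0\<close>.\<close>

definition realizable ::
    "(rat \<Rightarrow> 'v::ab_group_add \<Rightarrow> 'v) \<Rightarrow> nat \<Rightarrow> (nat \<Rightarrow> 'v \<Rightarrow> rat) \<Rightarrow> bool" where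
  "realizable scale r q \<longleftrightarrow>
     (let n = vector_space.dim scale UNIV; deg = form_degree scale in
       (\<forall>i\<le>r + 1. \<exists>d. algebraic_form scale d (q i)) \<and>
       (\<exists>s::nat. int s \<ge> max (int n) (\<lceil>(of_nat (deg (q r)) / of_nat (deg (q 0)) :: rat)\<rceil> + 1) \<and>
            q (r + 1) = (\<lambda>x. q 0 x ^ s)) \<and>
       (\<forall>i\<le>r. int (deg (q (i + 1))) - int (deg (q i)) > 1) \<and>
       (\<exists>v d l. dual_basis scale n v \<and> d > 1 \<and> (\<forall>i<n. l i \<noteq> 0) \<and>
            q 0 = (\<lambda>x. \<Sum>i<n. l i * v i x ^ d)))"

end

theory Submission
  imports Defs "HOL-Computational_Algebra.Polynomial"
begin

text \<open>
  Averaging an arbitrary inner product of \<open>M\<close> over \<open>G\<close> gives a \<open>G\<close>-invariant positive definite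
  form \<open>B\<close>, and a \<open>B\<close>-orthogonal basis diagonalizes \<open>q\<^sub>0(x) = B(x, x)\<close>. Two more forms suffice to
  cut \<open>G\<close> out of \<open>O(q\<^sub>0)\<close>, so that the family is \<open>q\<^sub>0, q\<^sub>1, q\<^sub>2, q\<^sub>0\<^sup>s\<close>; the last member is
  preserved by all of \<open>O(q\<^sub>0)\<close>. Both forms are sums of powers \<open>\<Sum>\<^sub>k B(x, u\<^sub>k)\<^sup>d\<close> over
  \<open>G\<close>-invariant finite families of vectors \<open>u\<^sub>k\<close>.

  If \<open>d\<close> is at least the number of vectors, powers of linear forms on distinct lines cannot
  cancel (\<open>sum_powers_on_line\<close>). So for large \<open>d\<close> such a sum determines, for every line, the total
  contribution of the vectors on it, and an isometry that preserves the sum preserves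
  these contributions (\<open>line_weight_isometry\<close>): it permutes the lines with nonzero
  contribution, and the image of a vector on such a line is known up to sign once the image
  line is known, because norms are preserved.

  For \<open>q\<^sub>1\<close> the family is the \<open>G\<close>-orbit of an orthogonal basis and the exponent is even, so no
  contribution vanishes. An isometry that preserves \<open>q\<^sub>1\<close> sends each basis vector into
  a fixed finite set; hence the group \<open>H\<close> of these isometries is finite, and it contains \<open>G\<close>
  and \<open>-1\<close>. Since a rational vector space is not a finite union of proper subspaces, there is a
  vector \<open>b\<close> at which the elements of \<open>H\<close> take pairwise distinct values. For \<open>q\<^sub>2\<close> the family is
  the \<open>G\<close>-orbit of \<open>b\<close>. If \<open>h \<in> H\<close> preserves \<open>q\<^sub>2\<close>, then \<open>g b = \<plusminus>h b\<close> for some \<open>g \<in> G\<close>, and the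
  choice of \<open>b\<close> gives \<open>h = \<plusminus>g\<close>. The sign is settled by parity: the exponent of \<open>q\<^sub>2\<close> is even
  exactly if \<open>-1 \<in> G\<close>, so either the sign is \<open>+\<close> or both signs give an element of \<open>G\<close>.
\<close>

section \<open>Sums of powers of linear forms\<close>

text \<open>
  The sum is a polynomial function of \<open>t\<close>, and the conclusion is its linear coefficient up to
  the factor \<open>m + 1\<close>.
\<close>

lemma sum_powers_linear_coefficient:
  fixes c \<alpha> \<beta> :: "'k \<Rightarrow> rat"
  assumes "\<And>t. (\<Sum>k\<in>K. c k * (\<alpha> k + t * \<beta> k) ^ Suc m) = 0"
  shows "(\<Sum>k\<in>K. c k * \<beta> k * \<alpha> k ^ m) = 0"
proof -
  define p where "p = (\<Sum>k\<in>K. smult (c k) ([:\<alpha> k, \<beta> k:] ^ Suc m))"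
  have "poly p t = 0" for t
    using assms[of t] by (simp add: p_def poly_sum poly_power del: power_Suc)
  then have "p = 0"
    using poly_all_0_iff_0[of p] by blast
  then have "poly (pderiv p) 0 = 0"
    by simp
  moreover have "poly (pderiv p) 0 = of_nat (Suc m) * (\<Sum>k\<in>K. c k * \<beta> k * \<alpha> k ^ m)"
    by (simp add: p_def higher_pderiv_sum[of 1, simplified] pderiv_smult pderiv_power_Suc poly_sum poly_power
        sum_distrib_left pderiv_pCons mult_ac del: power_Suc of_nat_Suc)
  ultimately show ?thesis
    by (simp del: of_nat_Suc)
qed

locale rational_inner_product = vector_space scale
  for scale :: "rat \<Rightarrow> 'v::ab_group_add \<Rightarrow> 'v" (infixr \<open>*s\<close> 75) +
  fixes B :: "'v \<Rightarrow> 'v \<Rightarrow> rat"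
  assumes B_commute: "B x y = B y x"
    and B_add_left: "B (x + y) z = B x z + B y z"
    and B_scale_left: "B (c *s x) z = c * B x z"
    and B_pos: "x \<noteq> 0 \<Longrightarrow> B x x > 0"
begin

lemma B_add_right: "B z (x + y) = B z x + B z y"
  by (metis B_add_left B_commute)

lemma B_scale_right: "B z (c *s x) = c * B z x"
  by (metis B_scale_left B_commute)

lemma B_zero_left [simp]: "B 0 z = 0"
  using B_scale_left[of 0 0 z] by simp

lemma B_zero_right [simp]: "B z 0 = 0"
  by (metis B_zero_left B_commute)

lemma B_minus_left: "B (- x) z = - B x z"
  using B_add_left[of x "- x" z] by simp

lemma B_minus_right: "B z (- x) = - B z x"
  by (metis B_minus_left B_commute)

lemma B_diff_left: "B (x - y) z = B x z - B y z"
  using B_add_left[of x "- y" z] by (simp add: B_minus_left)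

lemma B_sum_left: "B (\<Sum>i\<in>I. f i) z = (\<Sum>i\<in>I. B (f i) z)"
  by (induction I rule: infinite_finite_induct) (auto simp: B_add_left)

lemma B_self_eq_0_iff: "B x x = 0 \<longleftrightarrow> x = 0"
  using B_pos[of x] by (metis B_zero_left less_irrefl)

text \<open>
  Replacing \<open>x\<close> by \<open>x + t y\<close> and taking the linear coefficient in \<open>t\<close> turns one factor
  \<open>B x (u k)\<close> into \<open>B y (u k)\<close>. In other words, a functional on homogeneous polynomials of
  degree \<open>d\<close> that
  kills all \<open>d\<close>-th powers of linear forms also kills products of \<open>d\<close> linear forms.
\<close>

lemma polarize_sum_powers:
  assumes zero: "\<And>x. (\<Sum>k\<in>K. c k * B x (u k) ^ d) = 0"
    and "finite J" "card J \<le> d"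
  shows "(\<Sum>k\<in>K. c k * (\<Prod>j\<in>J. B (y j) (u k)) * B x (u k) ^ (d - card J)) = 0"
  using assms(2,3)
proof (induction J arbitrary: x rule: finite_induct)
  case empty
  show ?case using zero by simp
next
  case (insert j J)
  define m where "m = d - card (insert j J)"
  have m: "d - card J = Suc m" "card J \<le> d"
    using insert by (auto simp: m_def)
  have "(\<Sum>k\<in>K. c k * (\<Prod>j\<in>J. B (y j) (u k)) * (B x (u k) + t * B (y j) (u k)) ^ Suc m) = 0" for t
    using insert.IH[of "x + t *s y j"] m by (simp add: B_add_left B_scale_left)
  from sum_powers_linear_coefficient[OF this] show ?case
    using insert by (simp add: mult_ac m_def)
qed

text \<open>
  Polarize with one vector \<open>y j\<close> for each \<open>u j\<close> off the line of \<open>s\<close>, orthogonal to \<open>u j\<close> but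
  not to \<open>s\<close>: this kills every term off the line and multiplies the others by a common
  nonzero constant. The bound on \<open>card K\<close> leaves room for all these factors.
\<close>

lemma sum_powers_on_line:
  assumes zero: "\<And>x. (\<Sum>k\<in>K. c k * B x (u k) ^ d) = 0"
    and K: "finite K" "card K \<le> d" and s: "s \<noteq> 0"
  shows "(\<Sum>k\<in>{k\<in>K. \<exists>a. u k = a *s s}. c k * B s (u k) ^ d) = 0"
proof -
  define L where "L = {k\<in>K. \<exists>a. u k = a *s s}"
  define J where "J = K - L"
  \<comment> \<open>The component of \<open>s\<close> orthogonal to \<open>u j\<close>; for \<open>u j = 0\<close> the division gives \<open>0\<close>, but then
    \<open>u j\<close> lies on the line of \<open>s\<close> and \<open>j\<close> is not in \<open>J\<close>.\<close>
  define y where "y j = s - (B s (u j) / B (u j) (u j)) *s u j" for j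
  have J: "finite J" "card J \<le> d"
    using K card_mono[of K J] by (auto simp: J_def)
  have y_orth: "B (y j) (u j) = 0" for j
    using B_self_eq_0_iff[of "u j"] by (auto simp: y_def B_diff_left B_scale_left)
  have y_s: "B (y j) s \<noteq> 0" if "j \<in> J" for j
  proof -
    have "y j \<noteq> 0"
    proof
      define a where "a = B s (u j) / B (u j) (u j)"
      assume "y j = 0"
      then have *: "s = a *s u j" by (simp add: y_def a_def)
      with s have "a \<noteq> 0" by auto
      with * have "u j = inverse a *s s" by simp
      with that show False by (auto simp: J_def L_def)
    qed
    moreover have "B (y j) (y j) = B (y j) s"
    proof -
      have "B (y j) (y j) = B (s - (B s (u j) / B (u j) (u j)) *s u j) (y j)"
        by (simp only: y_def)
      also have "\<dots> = B s (y j) - (B s (u j) / B (u j) (u j)) * B (u j) (y j)"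
        by (simp only: B_diff_left B_scale_left)
      finally show ?thesis
        using y_orth[of j] by (simp add: B_commute[of s "y j"] B_commute[of "u j" "y j"])
    qed
    ultimately show ?thesis
      using B_self_eq_0_iff[of "y j"] by auto
  qed
  define P where "P = (\<Prod>j\<in>J. B (y j) s)"
  have P: "P \<noteq> 0"
    using y_s J by (auto simp: P_def)
  have off_line: "(\<Prod>j\<in>J. B (y j) (u k)) = 0" if "k \<in> K - L" for k
    using that y_orth J by (auto simp: J_def intro!: prod_zero bexI[of _ k])
  have on_line: "(\<Prod>j\<in>J. B (y j) (u k)) * B s (u k) ^ (d - card J) * B s s ^ card J
      = P * B s (u k) ^ d" if k: "k \<in> L" for k
  proof -
    from k obtain a where a: "u k = a *s s" by (auto simp: L_def)
    have "a ^ card J * a ^ (d - card J) = a ^ d" "B s s ^ card J * B s s ^ (d - card J) = B s s ^ d"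
      using J by (simp_all flip: power_add)
    then show ?thesis
      by (simp add: a B_scale_right P_def prod.distrib power_mult_distrib mult_ac)
  qed
  have "0 = (\<Sum>k\<in>K. c k * (\<Prod>j\<in>J. B (y j) (u k)) * B s (u k) ^ (d - card J)) * B s s ^ card J"
    using polarize_sum_powers[OF zero J, of y s] by simp
  also have "\<dots> = (\<Sum>k\<in>L. c k * (\<Prod>j\<in>J. B (y j) (u k)) * B s (u k) ^ (d - card J)) * B s s ^ card J"
    by (intro arg_cong2[of _ _ _ _ "(*)"] sum.mono_neutral_right refl K)
      (auto simp: L_def off_line)
  also have "\<dots> = P * (\<Sum>k\<in>L. c k * B s (u k) ^ d)"
    unfolding sum_distrib_right sum_distrib_left
    by (intro sum.cong refl) (use on_line in \<open>simp add: mult_ac\<close>)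
  finally show ?thesis
    using P by (simp add: L_def)
qed

text \<open>
  The contribution of the line of \<open>s\<close> to \<open>\<Sum>k\<in>K. B x (u k) ^ d\<close>, evaluated at the point \<open>s\<close>.
  For large \<open>d\<close> it depends on the sum only, not on the vectors \<open>u k\<close>.
\<close>

definition line_weight :: "'k set \<Rightarrow> ('k \<Rightarrow> 'v) \<Rightarrow> nat \<Rightarrow> 'v \<Rightarrow> rat" where
  "line_weight K u d s = (\<Sum>k\<in>{k\<in>K. \<exists>a. u k = a *s s}. B s (u k) ^ d)"

definition power_form :: "'k set \<Rightarrow> ('k \<Rightarrow> 'v) \<Rightarrow> nat \<Rightarrow> 'v \<Rightarrow> rat" where
  "power_form K u d = (\<lambda>x. \<Sum>k\<in>K. B x (u k) ^ d)"

text \<open>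
  The difference of the two sums of powers vanishes; it is indexed by the disjoint union of
  the index sets, with coefficients \<open>1\<close> and \<open>-1\<close>.
\<close>

lemma line_weight_cong:
  assumes eq: "power_form K u d = power_form K' u' d"
    and fin: "finite K" "finite K'" and d: "card K + card K' \<le> d" and s: "s \<noteq> 0"
  shows "line_weight K u d s = line_weight K' u' d s"
proof -
  define c :: "'a + 'b \<Rightarrow> rat" where "c k = (case k of Inl _ \<Rightarrow> 1 | Inr _ \<Rightarrow> - 1)" for k
  define w where "w = case_sum u u'"
  have split: "{k\<in>K <+> K'. \<exists>a. w k = a *s s}
      = {k\<in>K. \<exists>a. u k = a *s s} <+> {k\<in>K'. \<exists>a. u' k = a *s s}"
    by (auto simp: w_def)
  have "(\<Sum>k\<in>K <+> K'. c k * B x (w k) ^ d) = 0" for x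
    using fun_cong[OF eq, of x] fin
    by (simp add: power_form_def sum.Plus c_def w_def sum_negf)
  then have "(\<Sum>k\<in>{k\<in>K <+> K'. \<exists>a. w k = a *s s}. c k * B s (w k) ^ d) = 0"
    by (rule sum_powers_on_line) (use fin d s in \<open>auto simp: card_Plus\<close>)
  then show ?thesis
    unfolding split line_weight_def using fin
    by (simp add: sum.Plus c_def w_def sum_negf)
qed

section \<open>Isometries preserving a sum of powers\<close>

definition isometry :: "('v \<Rightarrow> 'v) \<Rightarrow> bool" where
  "isometry h \<longleftrightarrow> Vector_Spaces.linear scale scale h \<and> bij h \<and> (\<forall>x y. B (h x) (h y) = B x y)"

text \<open>
  By polarization, \<open>B x x\<close> determines \<open>B\<close>, so the isometries form the orthogonal group of \<open>q\<^sub>0\<close>.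
\<close>

lemma isometry_iff:
  "isometry h \<longleftrightarrow> h \<in> carrier (GL scale) \<and> (\<lambda>x. B x x) \<circ> h = (\<lambda>x. B x x)"
proof
  assume h: "h \<in> carrier (GL scale) \<and> (\<lambda>x. B x x) \<circ> h = (\<lambda>x. B x x)"
  then have lin: "h (x + y) = h x + h y" for x y
    by (simp add: GL_def Vector_Spaces.linear_iff)
  have q: "B (h x) (h x) = B x x" for x
    using h by (auto simp: fun_eq_iff)
  have "B (h x) (h y) = B x y" for x y
    using q[of "x + y"] q[of x] q[of y] B_commute[of y x] B_commute[of "h y" "h x"]
    by (simp add: lin B_add_left B_add_right)
  with h show "isometry h"
    by (simp add: isometry_def GL_def)
qed (auto simp: isometry_def GL_def fun_eq_iff)

lemma isometryD:
  assumes "isometry h"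
  shows "h (x + y) = h x + h y" "h (a *s x) = a *s h x" "B (h x) (h y) = B x y" "bij h" "h x = 0 \<longleftrightarrow> x = 0"
proof -
  have lin: "Vector_Spaces.linear scale scale h" using assms by (simp add: isometry_def)
  then show add: "h (x + y) = h x + h y" and scale: "h (a *s x) = a *s h x" for x y a
    by (simp_all add: Vector_Spaces.linear_iff)
  show B: "B (h x) (h y) = B x y" "bij h" for x y using assms by (auto simp: isometry_def)
  show "h x = 0 \<longleftrightarrow> x = 0" using B(1)[of x x] B_self_eq_0_iff by metis
qed

text \<open>
  Evaluating at \<open>h x\<close> shows that the families \<open>u\<close> and \<open>h \<circ> u\<close> have the same sum of powers, so
  they have the same weight on the line of \<open>h s\<close>. The factor \<open>2\<close> comes from comparing two
  families of size \<open>card K\<close>.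
\<close>

lemma line_weight_isometry:
  assumes h: "isometry h" and inv: "power_form K u d \<circ> h = power_form K u d"
    and K: "finite K" "2 * card K \<le> d" and s: "s \<noteq> 0"
  shows "line_weight K u d (h s) = line_weight K u d s"
proof -
  have "power_form K (h \<circ> u) d = power_form K u d"
  proof
    fix y
    obtain x where y: "y = h x"
      using isometryD(4)[OF h] by (meson bij_pointE)
    show "power_form K (h \<circ> u) d y = power_form K u d y"
      using fun_cong[OF inv, of x] by (simp add: y power_form_def isometryD[OF h])
  qed
  then have "line_weight K (h \<circ> u) d (h s) = line_weight K u d (h s)"
    by (rule line_weight_cong) (use K s isometryD(5)[OF h] in auto)
  moreover have "h (u k) = a *s h s \<longleftrightarrow> u k = a *s s" for k a
    using inj_eq[OF bij_is_inj[OF isometryD(4)[OF h]], of "u k" "a *s s"]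
    by (simp add: isometryD(2)[OF h])
  then have "line_weight K (h \<circ> u) d (h s) = line_weight K u d s"
    by (simp add: line_weight_def isometryD[OF h])
  ultimately show ?thesis by simp
qed

text \<open>
  A positive weight on the line of \<open>h s\<close> needs a positive term. The condition \<open>a ^ d > 0\<close>
  carries the sign information: for odd \<open>d\<close> it forces \<open>a > 0\<close>.
\<close>

lemma isometry_image_on_line:
  assumes h: "isometry h" and inv: "power_form K u d \<circ> h = power_form K u d"
    and K: "finite K" "2 * card K \<le> d" and s: "s \<noteq> 0"
    and pos: "line_weight K u d s > 0"
  obtains k a where "k \<in> K" "u k = a *s h s" "a ^ d > 0"
proof -
  have "line_weight K u d (h s) > 0"
    using line_weight_isometry[OF h inv K s] pos by simp
  then obtain k where k: "k \<in> K" "\<exists>a. u k = a *s h s" "B (h s) (u k) ^ d > 0"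
    unfolding line_weight_def using sum_nonpos[of "{k\<in>K. \<exists>a. u k = a *s h s}" "\<lambda>k. B (h s) (u k) ^ d"]
    by (force simp: not_le)
  then obtain a where a: "u k = a *s h s" by blast
  have "B (h s) (h s) > 0"
    using B_pos s isometryD(5)[OF h] by auto
  then have "a ^ d > 0"
    using k(3) a by (simp add: B_scale_right power_mult_distrib zero_less_mult_iff)
  with k a that show ?thesis by blast
qed

lemma unit_ratio:
  assumes "x = a *s y" "B x x = B y y" "y \<noteq> 0"
  shows "a = 1 \<or> a = - 1"
proof -
  have "a * a = 1"
    using assms B_pos[of y] by (simp add: B_scale_left B_scale_right)
  then show ?thesis by (simp add: square_eq_1_iff)
qed

text \<open>
  A line meets a sphere in at most two points. Writing \<open>s\<close> as a nonzero multiple of \<open>x\<close>, rather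
  than \<open>x\<close> as a multiple of \<open>s\<close>, matches the form in which \<open>isometry_image_on_line\<close> delivers
  the images of basis vectors.
\<close>

lemma finite_line_Int_sphere: "finite {x. B x x = c \<and> (\<exists>a. s = a *s x \<and> a \<noteq> 0)}"
proof (cases "\<exists>x0. x0 \<in> {x. B x x = c \<and> (\<exists>a. s = a *s x \<and> a \<noteq> 0)}")
  case True
  then obtain x0 a0 where x0: "B x0 x0 = c" "s = a0 *s x0" "a0 \<noteq> 0" by auto
  have "x = x0 \<or> x = - x0" if x: "B x x = c" "s = a *s x" "a \<noteq> 0" for x a
  proof (cases "x0 = 0")
    case True
    with x0 x show ?thesis by auto
  next
    case False
    have "x = inverse a *s s" using x by simp
    then have "x = (inverse a * a0) *s x0" using x0 by simp
    from unit_ratio[OF this] this x0 x False show ?thesis by auto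
  qed
  then have "{x. B x x = c \<and> (\<exists>a. s = a *s x \<and> a \<noteq> 0)} \<subseteq> {x0, - x0}" by auto
  then show ?thesis by (rule finite_subset) simp
next
  case False
  then show ?thesis by (metis (no_types, lifting) equals0I finite.emptyI)
qed

text \<open>
  Every spanning vector \<open>e\<close> is sent to a vector of the same norm on the line of some \<open>u k\<close>, so
  only finitely many images are possible, and the images of \<open>E\<close> determine the isometry.
\<close>

lemma finite_isometries_preserving_power_form:
  assumes E: "finite E" "span E = UNIV" "0 \<notin> E"
    and K: "finite K" "2 * card K \<le> d" and d: "d > 0"
    and pos: "\<And>e. e \<in> E \<Longrightarrow> line_weight K u d e > 0"
  shows "finite {h. isometry h \<and> power_form K u d \<circ> h = power_form K u d}" (is "finite ?H")
proof -
  define T where "T e = (\<Union>k\<in>K. {x. B x x = B e e \<and> (\<exists>a. u k = a *s x \<and> a \<noteq> 0)})" for e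
  have fin: "finite (PiE E T)"
    by (intro finite_PiE) (auto simp: T_def E K finite_line_Int_sphere)
  have sub: "(\<lambda>h. restrict h E) ` ?H \<subseteq> PiE E T"
  proof (clarify, intro PiE_I)
    fix h e assume h: "isometry h" "power_form K u d \<circ> h = power_form K u d" and e: "e \<in> E"
    then obtain k a where "k \<in> K" "u k = a *s h e" "a ^ d > 0"
      using isometry_image_on_line[OF h K _ pos[OF e]] E by metis
    moreover from \<open>a ^ d > 0\<close> d have "a \<noteq> 0"
      by (auto simp: zero_power)
    ultimately show "restrict h E e \<in> T e"
      using e isometryD(3)[OF h(1), of e e] unfolding T_def by auto
  qed auto
  have inj: "inj_on (\<lambda>h. restrict h E) ?H"
  proof (rule inj_onI, clarify)
    interpret vector_space_pair scale scale ..
    fix g h assume g: "isometry g" and h: "isometry h" and eq: "restrict g E = restrict h E"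
    have "g b = h b" if "b \<in> E" for b
      using fun_cong[OF eq, of b] that by simp
    then have "g x = h x" for x
      by (intro linear_eq_on[of g h x E]) (use g h E(2) in \<open>auto simp: isometry_def\<close>)
    then show "g = h" by blast
  qed
  show ?thesis
    by (rule inj_on_finite[OF inj sub fin])
qed

end

section \<open>Homogeneous polynomials in given coordinates\<close>

text \<open>
  The polynomial condition of \<open>algebraic_form\<close> for one chosen family of coordinates \<open>v\<close>. Closure
  under sums and products needs common coordinates for the operands.
\<close>

definition homogeneous_in :: "nat \<Rightarrow> (nat \<Rightarrow> 'v \<Rightarrow> rat) \<Rightarrow> nat \<Rightarrow> ('v \<Rightarrow> rat) \<Rightarrow> bool" where
  "homogeneous_in n v d q \<longleftrightarrow>
     (\<exists>c. q = (\<lambda>x. \<Sum>\<alpha>\<in>exponents n d. c \<alpha> * (\<Prod>i<n. v i x ^ \<alpha> i)))"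

lemma homogeneous_in_add:
  assumes "homogeneous_in n v d p" "homogeneous_in n v d q"
  shows "homogeneous_in n v d (\<lambda>x. p x + q x)"
proof -
  obtain c c' where "p = (\<lambda>x. \<Sum>\<alpha>\<in>exponents n d. c \<alpha> * (\<Prod>i<n. v i x ^ \<alpha> i))"
    "q = (\<lambda>x. \<Sum>\<alpha>\<in>exponents n d. c' \<alpha> * (\<Prod>i<n. v i x ^ \<alpha> i))"
    using assms by (auto simp: homogeneous_in_def)
  then show ?thesis
    unfolding homogeneous_in_def
    by (intro exI[of _ "\<lambda>\<alpha>. c \<alpha> + c' \<alpha>"]) (simp add: distrib_right sum.distrib)
qed

lemma homogeneous_in_cmult:
  assumes "homogeneous_in n v d q"
  shows "homogeneous_in n v d (\<lambda>x. a * q x)"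
proof -
  obtain c where "q = (\<lambda>x. \<Sum>\<alpha>\<in>exponents n d. c \<alpha> * (\<Prod>i<n. v i x ^ \<alpha> i))"
    using assms by (auto simp: homogeneous_in_def)
  then show ?thesis
    unfolding homogeneous_in_def
    by (intro exI[of _ "\<lambda>\<alpha>. a * c \<alpha>"]) (simp add: sum_distrib_left mult_ac)
qed

lemma homogeneous_in_sum:
  assumes "\<And>k. k \<in> K \<Longrightarrow> homogeneous_in n v d (q k)"
  shows "homogeneous_in n v d (\<lambda>x. \<Sum>k\<in>K. q k x)"
  using assms
proof (induction K rule: infinite_finite_induct)
  case (insert k K)
  then show ?case by (simp add: homogeneous_in_add)
qed (auto simp: homogeneous_in_def intro!: exI[of _ "\<lambda>_. 0"])

lemma homogeneous_in_monomial:
  assumes "\<alpha> \<in> exponents n d"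
  shows "homogeneous_in n v d (\<lambda>x. \<Prod>i<n. v i x ^ \<alpha> i)"
  unfolding homogeneous_in_def
  by (intro exI[of _ "\<lambda>\<beta>. if \<beta> = \<alpha> then 1 else 0"])
    (simp add: assms finite_exponents if_distrib[of "\<lambda>a. a * _"] cong: if_cong)

lemma homogeneous_in_mult:
  assumes "homogeneous_in n v d p" "homogeneous_in n v e q"
  shows "homogeneous_in n v (d + e) (\<lambda>x. p x * q x)"
proof -
  obtain c c' where pq: "p = (\<lambda>x. \<Sum>\<alpha>\<in>exponents n d. c \<alpha> * (\<Prod>i<n. v i x ^ \<alpha> i))"
    "q = (\<lambda>x. \<Sum>\<alpha>\<in>exponents n e. c' \<alpha> * (\<Prod>i<n. v i x ^ \<alpha> i))"
    using assms by (auto simp: homogeneous_in_def)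
  have "(\<lambda>x. p x * q x) = (\<lambda>x. \<Sum>\<alpha>\<in>exponents n d. \<Sum>\<beta>\<in>exponents n e.
      (c \<alpha> * c' \<beta>) * (\<Prod>i<n. v i x ^ (\<alpha> i + \<beta> i)))"
    by (simp add: pq sum_product power_add prod.distrib mult.assoc mult.left_commute)
  moreover have "homogeneous_in n v (d + e) \<dots>"
    by (intro homogeneous_in_sum homogeneous_in_cmult homogeneous_in_monomial)
      (auto simp: exponents_def sum.distrib)
  ultimately show ?thesis
    by metis
qed

lemma homogeneous_in_power:
  assumes "homogeneous_in n v d q"
  shows "homogeneous_in n v (d * m) (\<lambda>x. q x ^ m)"
proof (induction m)
  case 0
  show ?case
    using homogeneous_in_monomial[of "\<lambda>_. 0" n 0 v] by (simp add: exponents_def)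
next
  case (Suc m)
  show ?case
    using homogeneous_in_mult[OF assms Suc] by (simp add: add.commute)
qed

lemma homogeneous_in_coordinate:
  assumes "i < n"
  shows "homogeneous_in n v 1 (v i)"
proof -
  have "v i x = (\<Prod>j<n. v j x ^ (if j = i then 1 else 0))" for x
    using assms by (simp add: if_distrib[of "\<lambda>m. _ ^ m"] cong: if_cong)
  then have "v i = (\<lambda>x. \<Prod>j<n. v j x ^ (if j = i then 1 else 0))"
    by blast
  moreover have "homogeneous_in n v 1 (\<lambda>x. \<Prod>j<n. v j x ^ (if j = i then 1 else 0))"
    by (rule homogeneous_in_monomial) (use assms in \<open>auto simp: exponents_def\<close>)
  ultimately show ?thesis by metis
qed

lemma algebraic_formI:
  assumes "vector_space.dim scale UNIV = n" "dual_basis scale n v" "homogeneous_in n v d q"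
  shows "algebraic_form scale d q"
  using assms by (auto simp: algebraic_form_def homogeneous_in_def Let_def)

section \<open>Orthogonal bases\<close>

lemma sum_fun_scale_apply: "(\<Sum>k\<in>K. fun_scale (c k) (f k)) x = (\<Sum>k\<in>K. c k * f k x)"
  by (induction K rule: infinite_finite_induct) (auto simp: fun_scale_def)

context rational_inner_product
begin

lemma independent_orthogonal:
  fixes k :: nat
  assumes orth: "\<And>i j. i < k \<Longrightarrow> j < k \<Longrightarrow> i \<noteq> j \<Longrightarrow> B (e i) (e j) = 0"
    and nz: "\<And>i. i < k \<Longrightarrow> e i \<noteq> 0"
  shows "inj_on e {..<k}" "independent (e ` {..<k})"
proof -
  show inj: "inj_on e {..<k}"
    using orth nz by (metis B_self_eq_0_iff inj_onI lessThan_iff)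
  show "independent (e ` {..<k})"
  proof (rule independent_if_scalars_zero)
    fix f x assume sum: "(\<Sum>x\<in>e ` {..<k}. f x *s x) = 0" and "x \<in> e ` {..<k}"
    then obtain i where i: "i < k" "x = e i" by auto
    have "0 = B (\<Sum>j<k. f (e j) *s e j) x"
      using sum by (simp add: sum.reindex[OF inj])
    also have "\<dots> = (\<Sum>j<k. if j = i then f x * B x x else 0)"
      unfolding B_sum_left by (intro sum.cong) (auto simp: i orth B_scale_left)
    also have "\<dots> = f x * B x x"
      using i by (simp add: sum.delta)
    finally show "f x = 0"
      using nz i by (simp add: B_self_eq_0_iff)
  qed simp
qed

text \<open>
  The Gram--Schmidt step. It divides by norms but takes no square roots, so it works over the
  rationals and yields an orthogonal basis, in general not an orthonormal one.
\<close>

lemma residual_orthogonal: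
  fixes k :: nat
  assumes orth: "\<And>i j. i < k \<Longrightarrow> j < k \<Longrightarrow> i \<noteq> j \<Longrightarrow> B (e i) (e j) = 0"
    and nz: "\<And>i. i < k \<Longrightarrow> e i \<noteq> 0" and j: "j < k"
  shows "B (x - (\<Sum>i<k. (B x (e i) / B (e i) (e i)) *s e i)) (e j) = 0"
proof -
  have "(\<Sum>i<k. B ((B x (e i) / B (e i) (e i)) *s e i) (e j))
      = (\<Sum>i<k. if i = j then B x (e j) else 0)"
    using j nz orth by (intro sum.cong) (auto simp: B_scale_left B_self_eq_0_iff)
  then show ?thesis
    using j by (simp add: B_diff_left B_sum_left)
qed

lemma orthogonal_basis_exists:
  assumes n: "dim UNIV = n" "n \<ge> 1"
  obtains e where "\<And>i j. i < n \<Longrightarrow> j < n \<Longrightarrow> i \<noteq> j \<Longrightarrow> B (e i) (e j) = 0"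
    "\<And>i. i < n \<Longrightarrow> e i \<noteq> 0" "span (e ` {..<n}) = UNIV"
proof -
  obtain b where b: "independent b" "UNIV \<subseteq> span b" "card b = n"
    using basis_exists[of UNIV] n by metis
  then interpret fd: finite_dimensional_vector_space scale b
    using n by unfold_locales (auto intro: card_ge_0_finite)
  have "\<exists>e. (\<forall>i<k. e i \<noteq> 0) \<and> (\<forall>i<k. \<forall>j<k. i \<noteq> j \<longrightarrow> B (e i) (e j) = 0)" if "k \<le> n" for k
    using that
  proof (induction k)
    case (Suc k)
    then obtain e where nz: "\<And>i. i < k \<Longrightarrow> e i \<noteq> 0"
      and orth: "\<And>i j. i < k \<Longrightarrow> j < k \<Longrightarrow> i \<noteq> j \<Longrightarrow> B (e i) (e j) = 0"
      by auto
    have "dim (e ` {..<k}) < n"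
      using dim_le_card[of "e ` {..<k}" "e ` {..<k}"] span_superset card_image_le[of "{..<k}" e] Suc.prems by simp
    then have "span (e ` {..<k}) \<noteq> UNIV"
      using n by (metis dim_span less_irrefl)
    then obtain x where x: "x \<notin> span (e ` {..<k})" by auto
    define y where "y = x - (\<Sum>i<k. (B x (e i) / B (e i) (e i)) *s e i)"
    have y_nz: "y \<noteq> 0"
    proof
      assume "y = 0"
      then have "x = (\<Sum>i<k. (B x (e i) / B (e i) (e i)) *s e i)" by (simp add: y_def)
      also have "\<dots> \<in> span (e ` {..<k})"
        by (intro span_sum span_scale span_base) auto
      finally show False
        using x by blast
    qed
    have y_orth: "B y (e j) = 0" if "j < k" for j
      using residual_orthogonal[of k e j x] nz orth that by (simp add: y_def)
    show ?case
      using nz orth y_nz y_orth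
      by (intro exI[of _ "e(k := y)"]) (auto simp: less_Suc_eq B_commute[of _ y])
  qed auto
  from this[OF order_refl] obtain e where nz: "\<And>i. i < n \<Longrightarrow> e i \<noteq> 0"
    and orth: "\<And>i j. i < n \<Longrightarrow> j < n \<Longrightarrow> i \<noteq> j \<Longrightarrow> B (e i) (e j) = 0"
    by auto
  have "card (e ` {..<n}) = n"
    using card_image[OF independent_orthogonal(1)[of n e, OF orth nz]] by simp
  then have "UNIV \<subseteq> span (e ` {..<n})"
    using fd.card_ge_dim_independent[OF subset_UNIV independent_orthogonal(2)[of n e, OF orth nz]] n
    by simp
  with that nz orth show ?thesis by blast
qed

end

locale orthogonal_basis = rational_inner_product scale B
  for scale :: "rat \<Rightarrow> 'v::ab_group_add \<Rightarrow> 'v" (infixr \<open>*s\<close> 75) and B +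
  fixes n :: nat and e :: "nat \<Rightarrow> 'v"
  assumes orth: "i < n \<Longrightarrow> j < n \<Longrightarrow> i \<noteq> j \<Longrightarrow> B (e i) (e j) = 0"
    and nonzero: "i < n \<Longrightarrow> e i \<noteq> 0"
    and spanning: "span (e ` {..<n}) = UNIV"
begin

lemma dim_UNIV: "dim UNIV = n"
proof -
  have "dim UNIV = card (e ` {..<n})"
    using independent_orthogonal[of n e] orth nonzero spanning
    by (intro dim_eq_card) auto
  then show ?thesis
    using independent_orthogonal[of n e] orth nonzero by (simp add: card_image)
qed

lemma expansion: "x = (\<Sum>i<n. (B x (e i) / B (e i) (e i)) *s e i)"
proof -
  define y where "y = x - (\<Sum>i<n. (B x (e i) / B (e i) (e i)) *s e i)"
  have y_orth: "B (e j) y = 0" if "j < n" for j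
    using residual_orthogonal[of n e j x] nonzero orth that
    by (simp add: y_def B_commute[of "e j"])
  have "y \<in> span (e ` {..<n})"
    by (simp add: spanning)
  then have "B y y = 0"
  proof (rule span_induct[where P = "\<lambda>z. B z y = 0"])
    show "subspace {z. B z y = 0}"
      by (auto simp: subspace_def B_add_left B_scale_left)
  qed (use y_orth in auto)
  then show ?thesis
    by (simp add: B_self_eq_0_iff y_def)
qed

lemma B_expansion: "B x u = (\<Sum>i<n. (B (e i) u / B (e i) (e i)) * B (e i) x)"
  using arg_cong[OF expansion[of x], of "\<lambda>z. B z u"]
  by (simp add: B_sum_left B_scale_left B_commute[of x "e _"] mult.commute)

text \<open>
  The functionals \<open>B (e i)\<close> are, up to the nonzero scalars \<open>B (e i) (e i)\<close>, dual to the
  basis \<open>e\<close>.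
\<close>

lemma dual_basis: "dual_basis scale n (\<lambda>i. B (e i))"
proof -
  have inj: "inj_on (\<lambda>i. B (e i)) {..<n}"
    by (rule inj_onI) (metis B_self_eq_0_iff lessThan_iff nonzero orth)
  have "fun_space.independent ((\<lambda>i. B (e i)) ` {..<n})"
  proof (rule fun_space.independent_if_scalars_zero)
    fix f p assume sum: "(\<Sum>p\<in>(\<lambda>i. B (e i)) ` {..<n}. fun_scale (f p) p) = 0"
      and "p \<in> (\<lambda>i. B (e i)) ` {..<n}"
    then obtain i where i: "i < n" "p = B (e i)" by auto
    have "0 = (\<Sum>j<n. fun_scale (f (B (e j))) (B (e j))) (e i)"
      using sum by (simp add: sum.reindex[OF inj])
    also have "\<dots> = (\<Sum>j<n. if j = i then f p * B (e i) (e i) else 0)"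
      unfolding sum_fun_scale_apply by (intro sum.cong) (auto simp: i orth)
    also have "\<dots> = f p * B (e i) (e i)"
      using i by simp
    finally show "f p = 0"
      using nonzero i by (simp add: B_self_eq_0_iff)
  qed simp
  moreover have "fun_space.span ((\<lambda>i. B (e i)) ` {..<n}) = dual_space scale"
  proof
    show "fun_space.span ((\<lambda>i. B (e i)) ` {..<n}) \<subseteq> dual_space scale"
    proof (rule fun_space.span_minimal)
      have vs: "vector_space scale" "vector_space ((*) :: rat \<Rightarrow> rat \<Rightarrow> rat)"
        by unfold_locales (auto simp: algebra_simps)
      show "(\<lambda>i. B (e i)) ` {..<n} \<subseteq> dual_space scale"
        using vs by (auto simp: dual_space_def Vector_Spaces.linear_iff B_add_right B_scale_right)
      show "fun_space.subspace (dual_space scale)"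
        using vs by (auto simp: fun_space.subspace_def dual_space_def Vector_Spaces.linear_iff
            fun_scale_def algebra_simps)
    qed
    show "dual_space scale \<subseteq> fun_space.span ((\<lambda>i. B (e i)) ` {..<n})"
    proof
      fix f assume "f \<in> dual_space scale"
      then have f: "f (x + y) = f x + f y" "f (a *s x) = a * f x" for x y a
        by (auto simp: dual_space_def Vector_Spaces.linear_iff)
      have "f 0 = 0"
        using f(1)[of 0 0] by simp
      then have f_sum: "f (\<Sum>i\<in>I. g i) = (\<Sum>i\<in>I. f (g i))" for g :: "nat \<Rightarrow> 'v" and I
        by (induction I rule: infinite_finite_induct) (auto simp: f)
      have "f = (\<Sum>i<n. fun_scale (f (e i) / B (e i) (e i)) (B (e i)))"
      proof
        fix x
        show "f x = (\<Sum>i<n. fun_scale (f (e i) / B (e i) (e i)) (B (e i))) x"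
          unfolding sum_fun_scale_apply
          using arg_cong[OF expansion[of x], of f]
          by (simp add: f_sum f B_commute[of x "e _"] mult.commute)
      qed
      also have "\<dots> \<in> fun_space.span ((\<lambda>i. B (e i)) ` {..<n})"
        by (intro fun_space.span_sum fun_space.span_scale fun_space.span_base) auto
      finally show "f \<in> fun_space.span ((\<lambda>i. B (e i)) ` {..<n})" .
    qed
  qed
  ultimately show ?thesis
    using inj by (simp add: dual_basis_def)
qed

lemma algebraic_form_power_form: "algebraic_form scale d (power_form K u d)"
proof (rule algebraic_formI[OF dim_UNIV dual_basis])
  have "homogeneous_in n (\<lambda>i. B (e i)) 1 (\<lambda>x. B x (u k))" for k
    by (rule ssubst[where P = "homogeneous_in n _ 1", OF ext[OF B_expansion]])
      (intro homogeneous_in_sum homogeneous_in_cmult homogeneous_in_coordinate, auto)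
  from homogeneous_in_power[OF this, where m = d] show "homogeneous_in n (\<lambda>i. B (e i)) d (power_form K u d)"
    unfolding power_form_def by (intro homogeneous_in_sum) simp
qed

lemma norm_diagonal: "B x x = (\<Sum>i<n. (1 / B (e i) (e i)) * B (e i) x ^ 2)"
  using B_expansion[of x x] by (simp add: power2_eq_square)

lemma algebraic_form_norm_power: "algebraic_form scale (2 * m) (\<lambda>x. B x x ^ m)"
proof (rule algebraic_formI[OF dim_UNIV dual_basis], rule homogeneous_in_power)
  show "homogeneous_in n (\<lambda>i. B (e i)) 2 (\<lambda>x. B x x)"
    by (rule ssubst[where P = "homogeneous_in n _ 2", OF ext[OF norm_diagonal]])
      (intro homogeneous_in_sum homogeneous_in_cmult
        homogeneous_in_power[of n _ 1 _ 2, simplified] homogeneous_in_coordinate[simplified], auto)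
qed

end

section \<open>Vectors in general position\<close>

lemma (in vector_space) finite_scalars_affine_zero:
  fixes x y :: 'b
  assumes "x \<noteq> 0"
  shows "finite {t. x + scale t y = 0}"
proof -
  have "t = t'" if "x + scale t y = 0" "x + scale t' y = 0" for t t'
  proof -
    have "scale (t - t') y = 0"
      using that by (metis add_left_cancel right_minus_eq scale_left_diff_distrib)
    moreover have "y \<noteq> 0"
      using that assms by auto
    ultimately show ?thesis by simp
  qed
  then have "\<exists>t0. {t. x + scale t y = 0} \<subseteq> {t0}"
    by blast
  then show ?thesis
    using finite_subset by blast
qed

context rational_inner_product
begin

text \<open>
  A finite union of proper subspaces, here the kernels of the maps in \<open>A\<close>, is not everything:
  if \<open>x\<close> avoids all kernels but that of \<open>f\<close>, and \<open>z\<close> avoids that one, then \<open>x + t z\<close> avoids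
  all of them for all but finitely many \<open>t\<close>.
\<close>

lemma common_nonzero_value:
  assumes "finite A"
    and "\<And>f. f \<in> A \<Longrightarrow> Vector_Spaces.linear scale scale f"
    and "\<And>f. f \<in> A \<Longrightarrow> \<exists>x. f x \<noteq> 0"
  shows "\<exists>x. \<forall>f\<in>A. f x \<noteq> 0"
  using assms
proof (induction A rule: finite_induct)
  case (insert f A)
  then obtain x z where x: "\<And>g. g \<in> A \<Longrightarrow> g x \<noteq> 0" and z: "f z \<noteq> 0"
    by (metis insertCI)
  have lin: "g (x + t *s z) = g x + t *s g z" if "g \<in> insert f A" for g t
    using insert.prems(1)[OF that] by (simp add: Vector_Spaces.linear_iff)
  show ?case
  proof (cases "f x = 0")
    case False
    with x show ?thesis by auto
  next
    case True
    have "finite ({0} \<union> (\<Union>g\<in>A. {t. g x + t *s g z = 0}))"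
      using insert.hyps x by (auto intro: finite_scalars_affine_zero)
    from ex_new_if_finite[OF infinite_UNIV_char_0 this]
    obtain t where "t \<notin> {0} \<union> (\<Union>g\<in>A. {t. g x + t *s g z = 0})" by blast
    with True z show ?thesis
      by (intro exI[of _ "x + t *s z"]) (auto simp: lin)
  qed
qed auto

lemma isometries_separated_at_a_vector:
  assumes "finite H" "\<And>h. h \<in> H \<Longrightarrow> isometry h"
  obtains b where "\<And>g h. g \<in> H \<Longrightarrow> h \<in> H \<Longrightarrow> g b = h b \<Longrightarrow> g = h"
proof -
  define A where "A = (\<lambda>(g, h). \<lambda>x. g x - h x) ` {(g, h). g \<in> H \<and> h \<in> H \<and> g \<noteq> h}"
  have "finite A"
    unfolding A_def using assms(1)
    by (intro finite_imageI finite_subset[OF _ finite_cartesian_product[of H H]]) auto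
  moreover have "Vector_Spaces.linear scale scale f" if f: "f \<in> A" for f
  proof -
    obtain g h where "f = (\<lambda>x. g x - h x)" and gh: "isometry g" "isometry h"
      using f assms(2) by (auto simp: A_def)
    then show ?thesis
      using vector_space_axioms
      by (simp add: Vector_Spaces.linear_iff isometryD(1,2)[OF gh(1)] isometryD(1,2)[OF gh(2)]
          scale_right_diff_distrib)
  qed
  moreover have "\<exists>x. f x \<noteq> 0" if "f \<in> A" for f
    using that by (auto simp: A_def fun_eq_iff)
  ultimately obtain b where "\<forall>f\<in>A. f b \<noteq> 0"
    using common_nonzero_value[of A] by blast
  then have sep: "f \<in> A \<Longrightarrow> f b \<noteq> 0" for f
    by blast
  have "g = h" if gh: "g \<in> H" "h \<in> H" "g b = h b" for g h
  proof (rule ccontr)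
    assume "g \<noteq> h"
    with gh have "(\<lambda>x. g x - h x) \<in> A"
      by (auto simp: A_def)
    from sep[OF this] gh show False by simp
  qed
  with that show thesis by blast
qed

section \<open>Orbit sums\<close>

text \<open>
  The sum runs over pairs of a group element and an index, so a vector that occurs
  several times in the orbits is counted with multiplicity. Positivity of line weights
  is insensitive to this.
\<close>

definition orbit_form :: "('v \<Rightarrow> 'v) set \<Rightarrow> 'j set \<Rightarrow> ('j \<Rightarrow> 'v) \<Rightarrow> nat \<Rightarrow> 'v \<Rightarrow> rat" where
  "orbit_form \<Gamma> J w = power_form (\<Gamma> \<times> J) (\<lambda>(g, j). g (w j))"

text \<open>
  Left translation by \<open>h\<close> permutes \<open>\<Gamma>\<close>. Since \<open>\<Gamma>\<close> is finite, closure under composition is enough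
  for this.
\<close>

lemma orbit_form_invariant:
  assumes \<Gamma>: "finite \<Gamma>" "\<And>g h. g \<in> \<Gamma> \<Longrightarrow> h \<in> \<Gamma> \<Longrightarrow> g \<circ> h \<in> \<Gamma>" "\<And>g. g \<in> \<Gamma> \<Longrightarrow> isometry g"
    and h: "h \<in> \<Gamma>"
  shows "orbit_form \<Gamma> J w d \<circ> h = orbit_form \<Gamma> J w d"
proof
  fix x
  have inj: "inj_on ((\<circ>) h) \<Gamma>"
    by (rule inj_on_subset[OF fun.inj_map[OF bij_is_inj[OF isometryD(4)[OF \<Gamma>(3)[OF h]]]]]) simp
  then have "(\<circ>) h ` \<Gamma> = \<Gamma>"
    using \<Gamma> h by (intro endo_inj_surj) auto
  with inj have bij: "bij_betw ((\<circ>) h) \<Gamma> \<Gamma>"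
    by (simp add: bij_betw_def)
  have "orbit_form \<Gamma> J w d (h x) = (\<Sum>g\<in>\<Gamma>. \<Sum>j\<in>J. B (h x) (g (w j)) ^ d)"
    by (simp add: orbit_form_def power_form_def sum.cartesian_product case_prod_unfold)
  also have "\<dots> = (\<Sum>g\<in>\<Gamma>. \<Sum>j\<in>J. B (h x) ((h \<circ> g) (w j)) ^ d)"
    by (rule sum.reindex_bij_betw[OF bij, symmetric])
  also have "\<dots> = orbit_form \<Gamma> J w d x"
    by (simp add: isometryD(3)[OF \<Gamma>(3)[OF h]] orbit_form_def power_form_def
        sum.cartesian_product case_prod_unfold)
  finally show "(orbit_form \<Gamma> J w d \<circ> h) x = orbit_form \<Gamma> J w d x"
    by simp
qed

lemma line_weight_pos:
  assumes K: "finite K" and k0: "k0 \<in> K" "u k0 = s" and s: "s \<noteq> 0"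
    and nonneg: "\<And>k a. k \<in> K \<Longrightarrow> u k = a *s s \<Longrightarrow> a ^ d \<ge> 0"
  shows "line_weight K u d s > 0"
  unfolding line_weight_def
proof (rule sum_pos2[where i = k0])
  show "k0 \<in> {k \<in> K. \<exists>a. u k = a *s s}"
    using k0 by (auto intro: exI[of _ 1])
  show "0 < B s (u k0) ^ d"
    using k0 B_pos[OF s] by simp
  show "0 \<le> B s (u k) ^ d" if "k \<in> {k \<in> K. \<exists>a. u k = a *s s}" for k
    using that nonneg B_pos[OF s] by (auto simp: B_scale_right power_mult_distrib)
qed (use K in auto)

lemma power_form_nonzero:
  assumes "line_weight K u d s > 0" "finite K" "card K \<le> d" "s \<noteq> 0"
  shows "\<exists>x. power_form K u d x \<noteq> 0"
proof (rule ccontr)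
  assume "\<not> ?thesis"
  then have "power_form K u d = power_form ({} :: 'a set) u d"
    by (auto simp: fun_eq_iff power_form_def)
  from line_weight_cong[OF this, of s] assms show False
    by (simp add: line_weight_def)
qed

lemma isometry_uminus: "isometry h \<Longrightarrow> isometry (\<lambda>x. - h x)"
  unfolding isometry_def Vector_Spaces.linear_iff
  by (auto simp: B_minus_left B_minus_right bij_uminus
      intro: bij_comp[of h uminus, unfolded comp_def])

end

context orthogonal_basis
begin

text \<open>
  Here \<open>p1\<close> and \<open>p2\<close> are the forms \<open>q\<^sub>1\<close> and \<open>q\<^sub>2\<close> of the introduction. The bounds on the
  degrees make room for the required gaps: degree \<open>2\<close> before \<open>d1\<close>, and \<open>d1\<close> before \<open>d2\<close>.
\<close>

theorem finite_isometry_group_is_stabilizer: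
  assumes n: "n \<ge> 1"
    and \<Gamma>: "finite \<Gamma>" "id \<in> \<Gamma>" "\<And>g h. g \<in> \<Gamma> \<Longrightarrow> h \<in> \<Gamma> \<Longrightarrow> g \<circ> h \<in> \<Gamma>"
      "\<And>g. g \<in> \<Gamma> \<Longrightarrow> isometry g"
  obtains d1 d2 p1 p2 where
    "algebraic_form scale d1 p1" "\<exists>x. p1 x \<noteq> 0"
    "algebraic_form scale d2 p2" "\<exists>x. p2 x \<noteq> 0"
    "4 \<le> d1" "d1 + 2 \<le> d2"
    "\<Gamma> = {h. isometry h \<and> p1 \<circ> h = p1 \<and> p2 \<circ> h = p2}"
proof -
  \<comment> \<open>Even, at least twice the number of pairs in \<open>\<Gamma> \<times> {..<n}\<close>, and at least \<open>4\<close>.\<close>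
  define d1 where "d1 = 2 * (card \<Gamma> * n) + 2"
  define p1 where "p1 = orbit_form \<Gamma> {..<n} e d1"
  define H where "H = {h. isometry h \<and> p1 \<circ> h = p1}"
  have "even d1" by (simp add: d1_def)
  have "card \<Gamma> > 0"
    using \<Gamma> by (auto simp: card_gt_0_iff)
  then have "card \<Gamma> * n \<ge> 1"
    using n by simp
  then have d1: "d1 \<ge> 4" by (simp add: d1_def)
  have weight1: "line_weight (\<Gamma> \<times> {..<n}) (\<lambda>(g, j). g (e j)) d1 (e i) > 0" if "i < n" for i
    using that \<Gamma>(1,2) nonzero \<open>even d1\<close>
    by (intro line_weight_pos[of _ "(id, i)"]) (auto simp: zero_le_even_power)
  have nz1: "\<exists>x. p1 x \<noteq> 0"
    unfolding p1_def orbit_form_def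
    by (rule power_form_nonzero[OF weight1[of 0]])
      (use n nonzero \<Gamma>(1) in \<open>auto simp: d1_def card_cartesian_product\<close>)
  have "finite H"
    unfolding H_def p1_def orbit_form_def
    by (rule finite_isometries_preserving_power_form[of "e ` {..<n}"])
      (use weight1 spanning nonzero \<Gamma>(1) d1 in \<open>auto simp: d1_def card_cartesian_product\<close>)
  have \<Gamma>_H: "\<Gamma> \<subseteq> H"
    using \<Gamma> by (auto simp: H_def p1_def orbit_form_invariant)
  have uminus_H: "(\<lambda>x. - h x) \<in> H" if "h \<in> H" for h
    using that \<open>even d1\<close>
    by (auto simp: H_def isometry_uminus fun_eq_iff p1_def orbit_form_def power_form_def
        B_minus_left case_prod_unfold)
  obtain b where b: "\<And>g h. g \<in> H \<Longrightarrow> h \<in> H \<Longrightarrow> g b = h b \<Longrightarrow> g = h"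
    using isometries_separated_at_a_vector[OF \<open>finite H\<close>] by (auto simp: H_def)
  have b_nz: "b \<noteq> 0"
  proof
    assume "b = 0"
    moreover have "id \<in> H"
      using \<Gamma>_H \<Gamma>(2) by blast
    \<comment> \<open>At \<open>b = 0\<close> all elements of \<open>H\<close> would agree, in particular \<open>1\<close> and \<open>-1\<close>.\<close>
    ultimately have "(id :: 'v \<Rightarrow> 'v) = uminus"
      using b[of id uminus] uminus_H[of id] by simp
    from fun_cong[OF this, of "e 0"] have "B (e 0) (e 0) = B (- e 0) (e 0)"
      by simp
    then show False
      using nonzero[of 0] n B_pos[of "e 0"] by (simp add: B_minus_left)
  qed
  define d2 where "d2 = (if uminus \<in> \<Gamma> then d1 + 2 else d1 + 3)"
  have parity: "even d2 \<longleftrightarrow> uminus \<in> \<Gamma>"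
    using \<open>even d1\<close> by (simp add: d2_def)
  have d2: "d1 + 2 \<le> d2"
    by (simp add: d2_def)
  have "card \<Gamma> \<le> card \<Gamma> * n"
    using n by simp
  with d2 have card_d2: "2 * card \<Gamma> \<le> d2"
    unfolding d1_def by linarith
  define p2 where "p2 = orbit_form \<Gamma> {()} (\<lambda>_. b) d2"
  \<comment> \<open>Within \<open>H\<close>, proportional values at \<open>b\<close> force equality up to sign.\<close>
  have same_line: "(a = 1 \<and> g = h) \<or> (a = - 1 \<and> h = (\<lambda>x. - g x))"
    if g: "g \<in> \<Gamma>" and h: "h \<in> H" and gb: "g b = a *s h b" for g h a
  proof -
    have iso: "isometry g" "isometry h"
      using g h \<Gamma>_H by (auto simp: H_def)
    have "a = 1 \<or> a = - 1"
      by (rule unit_ratio[OF gb]) (use iso b_nz in \<open>auto simp: isometryD\<close>)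
    then show ?thesis
    proof
      assume "a = 1"
      then show ?thesis
        using b[of g h] g h gb \<Gamma>_H by auto
    next
      assume "a = - 1"
      then have "h b = - g b"
        using gb by simp
      then have "h = (\<lambda>x. - g x)"
        using b[OF h uminus_H[of g]] g \<Gamma>_H by auto
      with \<open>a = - 1\<close> show ?thesis by blast
    qed
  qed
  \<comment> \<open>Terms of \<open>p2\<close> on the line of \<open>b\<close> cannot cancel: a negative one would come from \<open>-1 \<in> \<Gamma>\<close>, but
    then the exponent is even.\<close>
  have "(a::rat) ^ d2 \<ge> 0" if g: "g \<in> \<Gamma>" and gb: "g b = a *s b" for g a
  proof -
    have "uminus \<in> \<Gamma>" if "id = (\<lambda>x. - g x)"
    proof -
      have "g = uminus"
        using that by (metis (no_types, opaque_lifting) add.inverse_inverse ext id_apply)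
      with g show ?thesis by simp
    qed
    moreover have "a = 1 \<or> a = - 1 \<and> id = (\<lambda>x. - g x)"
      using same_line[of g id a] g gb \<Gamma>(2) \<Gamma>_H by auto
    ultimately show ?thesis
      using parity by auto
  qed
  then have weight2: "line_weight (\<Gamma> \<times> {()}) (\<lambda>(g, j). g b) d2 b > 0"
    by (intro line_weight_pos[of _ "(id, ())"]) (use \<Gamma>(1,2) b_nz in auto)
  have nz2: "\<exists>x. p2 x \<noteq> 0"
    unfolding p2_def orbit_form_def
    by (rule power_form_nonzero[OF weight2])
      (use \<Gamma>(1) card_d2 b_nz in \<open>auto simp: card_cartesian_product\<close>)
  have "h \<in> \<Gamma>" if h: "h \<in> H" and inv: "p2 \<circ> h = p2" for h
  proof -
    obtain k a where k: "k \<in> \<Gamma> \<times> {()}" "(\<lambda>(g, j). g b) k = a *s h b" "a ^ d2 > 0"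
      using isometry_image_on_line[OF _ inv[unfolded p2_def orbit_form_def] _ _ b_nz weight2]
        h \<Gamma>(1) card_d2 by (auto simp: H_def card_cartesian_product)
    then obtain g where g: "g \<in> \<Gamma>" "g b = a *s h b" by auto
    from same_line[OF g(1) h g(2)] show ?thesis
    proof
      assume a: "a = - 1 \<and> h = (\<lambda>x. - g x)"
      \<comment> \<open>The sign \<open>-1\<close> is compatible with \<open>a ^ d2 > 0\<close> for even \<open>d2\<close> only, and then \<open>-1 \<in> \<Gamma>\<close>.\<close>
      then have "even d2"
        using k(3) by (cases "even d2") auto
      then have "uminus \<circ> g \<in> \<Gamma>"
        using parity \<Gamma>(3) g(1) by blast
      with a show ?thesis by (simp add: comp_def)
    qed (use g in auto)
  qed
  moreover have "p2 \<circ> h = p2" if "h \<in> \<Gamma>" for h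
    using that \<Gamma> by (simp add: p2_def orbit_form_invariant)
  ultimately have "\<Gamma> = {h \<in> H. p2 \<circ> h = p2}"
    using \<Gamma>_H by blast
  then have "\<Gamma> = {h. isometry h \<and> p1 \<circ> h = p1 \<and> p2 \<circ> h = p2}"
    unfolding H_def by blast
  moreover have "algebraic_form scale d1 p1" "algebraic_form scale d2 p2"
    unfolding p1_def p2_def orbit_form_def by (rule algebraic_form_power_form)+
  ultimately show ?thesis
    by (intro that[OF _ nz1 _ nz2 d1 d2])
qed

end

section \<open>Invariant inner products\<close>

text \<open>
  The average over \<open>\<Gamma>\<close> of the standard inner product in some basis.
\<close>

lemma invariant_inner_product_exists:
  fixes scale :: "rat \<Rightarrow> 'v::ab_group_add \<Rightarrow> 'v"
  assumes vs: "vector_space scale" and dim: "vector_space.dim scale UNIV \<ge> 1"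
    and \<Gamma>: "finite \<Gamma>" "id \<in> \<Gamma>" "\<And>g h. g \<in> \<Gamma> \<Longrightarrow> h \<in> \<Gamma> \<Longrightarrow> g \<circ> h \<in> \<Gamma>"
      "\<And>g. g \<in> \<Gamma> \<Longrightarrow> Vector_Spaces.linear scale scale g" "\<And>g. g \<in> \<Gamma> \<Longrightarrow> bij g"
  obtains B where "rational_inner_product scale B" "\<And>g x y. g \<in> \<Gamma> \<Longrightarrow> B (g x) (g y) = B x y"
proof -
  interpret vector_space scale by (fact vs)
  obtain b where b: "independent b" "UNIV \<subseteq> span b" "card b = dim UNIV"
    using basis_exists[of UNIV] by metis
  then have b_span: "span b = UNIV" and b_fin: "finite b"
    using dim by (auto intro: card_ge_0_finite)
  define coord where "coord x k = representation b x k" for x k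
  have coord_add: "coord (x + y) k = coord x k + coord y k" for x y k
    using b b_span by (simp add: coord_def representation_add)
  have coord_scale: "coord (scale a x) k = a * coord x k" for a x k
    using b b_span by (simp add: coord_def representation_scale)
  have coord_0: "x = 0" if "\<And>k. k \<in> b \<Longrightarrow> coord x k = 0" for x
    using sum_representation_eq[OF b(1) _ b_fin order_refl, of x] b_span that
    by (simp add: coord_def)
  define B0 where "B0 x y = (\<Sum>k\<in>b. coord x k * coord y k)" for x y
  have B0_nonneg: "B0 x x \<ge> 0" for x
    unfolding B0_def by (intro sum_nonneg) simp
  have B0_pos: "B0 x x > 0" if "x \<noteq> 0" for x
  proof -
    obtain k where "k \<in> b" "coord x k \<noteq> 0"
      using coord_0 \<open>x \<noteq> 0\<close> by blast
    then show ?thesis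
      unfolding B0_def using b_fin
      by (intro sum_pos2[of _ k]) (auto simp: zero_less_mult_iff linorder_neq_iff)
  qed
  define B where "B x y = (\<Sum>g\<in>\<Gamma>. B0 (g x) (g y))" for x y
  have lin: "g (x + y) = g x + g y" "g (scale a x) = scale a (g x)" if "g \<in> \<Gamma>" for g x y a
    using \<Gamma>(4)[OF that] by (auto simp: Vector_Spaces.linear_iff)
  have "rational_inner_product scale B"
  proof unfold_locales
    show "B x y = B y x" for x y
      by (simp add: B_def B0_def mult.commute)
    show "B (x + y) z = B x z + B y z" for x y z
      by (simp add: B_def B0_def lin coord_add distrib_right sum.distrib)
    show "B (scale a x) z = a * B x z" for a x z
      by (simp add: B_def B0_def lin coord_scale sum_distrib_left mult.assoc)
    show "B x x > 0" if "x \<noteq> 0" for x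
      unfolding B_def using \<Gamma>(1,2) B0_nonneg B0_pos[OF that]
      by (intro sum_pos2[of _ id]) auto
  qed
  moreover have "B (h x) (h y) = B x y" if h: "h \<in> \<Gamma>" for h x y
  proof -
    have inj: "inj_on (\<lambda>g. g \<circ> h) \<Gamma>"
      by (rule inj_onI, rule surj_fun_eq[OF bij_is_surj[OF \<Gamma>(5)[OF h]]]) (auto dest: fun_cong)
    then have "(\<lambda>g. g \<circ> h) ` \<Gamma> = \<Gamma>"
      using \<Gamma> h by (intro endo_inj_surj) auto
    with inj have "bij_betw (\<lambda>g. g \<circ> h) \<Gamma> \<Gamma>"
      by (simp add: bij_betw_def)
    from sum.reindex_bij_betw[OF this, of "\<lambda>g. B0 (g x) (g y)"] show ?thesis
      by (simp add: B_def)
  qed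
  ultimately show ?thesis using that by blast
qed

section \<open>Finite groups as orthogonal groups\<close>

theorem theorem2p3:
  fixes G :: "('g, 'b) monoid_scheme"
    and scale :: "rat \<Rightarrow> 'v::ab_group_add \<Rightarrow> 'v"
    and \<phi> :: "'g \<Rightarrow> 'v \<Rightarrow> 'v"
    and n :: nat
  assumes "group G" and "finite (carrier G)"
    and "vector_space scale" and "vector_space.dim scale UNIV = n" and "n \<ge> 1"
    and "faithful_module G scale \<phi>"
  shows "\<exists>(r::nat) (q :: nat \<Rightarrow> 'v \<Rightarrow> rat).
           realizable scale r q \<and>
           form_degree scale (q 0) = 2 \<and>
           \<phi> ` carrier G = orthogonal_group scale (q ` {0..r + 1})"
proof -
  interpret G: group G by (fact assms)
  define \<Gamma> where "\<Gamma> = \<phi> ` carrier G"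
  have GL: "\<phi> x \<in> carrier (GL scale)" if "x \<in> carrier G" for x
    using assms(6) that by (auto simp: faithful_module_def hom_def)
  have mult: "\<phi> (x \<otimes>\<^bsub>G\<^esub> y) = \<phi> x \<circ> \<phi> y" if "x \<in> carrier G" "y \<in> carrier G" for x y
    using assms(6) that by (auto simp: faithful_module_def hom_def GL_def)
  have \<Gamma>_GL: "Vector_Spaces.linear scale scale g" "bij g" if "g \<in> \<Gamma>" for g
    using that GL by (auto simp: \<Gamma>_def GL_def)
  have \<Gamma>_fin: "finite \<Gamma>"
    using assms(2) by (simp add: \<Gamma>_def)
  have \<Gamma>_comp: "g \<circ> h \<in> \<Gamma>" if gh: "g \<in> \<Gamma>" "h \<in> \<Gamma>" for g h
  proof -
    obtain x y where "x \<in> carrier G" "y \<in> carrier G" "g = \<phi> x" "h = \<phi> y"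
      using gh by (auto simp: \<Gamma>_def)
    then show ?thesis
      by (auto simp: \<Gamma>_def simp flip: mult)
  qed
  have "\<phi> \<one>\<^bsub>G\<^esub> = id"
  proof
    fix x
    have "inj (\<phi> \<one>\<^bsub>G\<^esub>)"
      using GL[of "\<one>\<^bsub>G\<^esub>"] by (simp add: GL_def bij_is_inj)
    moreover have "\<phi> \<one>\<^bsub>G\<^esub> (\<phi> \<one>\<^bsub>G\<^esub> x) = \<phi> \<one>\<^bsub>G\<^esub> x"
      using fun_cong[OF mult[of "\<one>\<^bsub>G\<^esub>" "\<one>\<^bsub>G\<^esub>"], of x] by simp
    ultimately show "\<phi> \<one>\<^bsub>G\<^esub> x = id x"
      by (simp add: inj_eq)
  qed
  then have \<Gamma>_id: "id \<in> \<Gamma>"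
    by (metis G.one_closed \<Gamma>_def imageI)
  obtain B where "rational_inner_product scale B"
    and B_inv: "\<And>g x y. g \<in> \<Gamma> \<Longrightarrow> B (g x) (g y) = B x y"
    using invariant_inner_product_exists[OF assms(3) _ \<Gamma>_fin \<Gamma>_id \<Gamma>_comp \<Gamma>_GL] assms(4,5)
    by metis
  then interpret rational_inner_product scale B by simp
  obtain e where "\<And>i j. i < n \<Longrightarrow> j < n \<Longrightarrow> i \<noteq> j \<Longrightarrow> B (e i) (e j) = 0"
    "\<And>i. i < n \<Longrightarrow> e i \<noteq> 0" "span (e ` {..<n}) = UNIV"
    using orthogonal_basis_exists[OF assms(4,5)] by metis
  then interpret orthogonal_basis scale B n e
    by unfold_locales auto
  have \<Gamma>_iso: "isometry g" if "g \<in> \<Gamma>" for g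
    using that \<Gamma>_GL B_inv by (simp add: isometry_def)
  obtain d1 d2 p1 p2 where p1: "algebraic_form scale d1 p1" "\<exists>x. p1 x \<noteq> 0"
    and p2: "algebraic_form scale d2 p2" "\<exists>x. p2 x \<noteq> 0" and d: "4 \<le> d1" "d1 + 2 \<le> d2"
    and stab: "\<Gamma> = {h. isometry h \<and> p1 \<circ> h = p1 \<and> p2 \<circ> h = p2}"
    by (rule finite_isometry_group_is_stabilizer[OF assms(5) \<Gamma>_fin \<Gamma>_id \<Gamma>_comp \<Gamma>_iso])
  \<comment> \<open>Large enough for both lower bounds on the exponent, and then \<open>2 * s\<close> also exceeds \<open>d2 + 1\<close>.\<close>
  define s where "s = n + d2 + 1"
  define q where "q i = (if i = 0 then (\<lambda>x. B x x) else if i = 1 then p1 else if i = 2 then p2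
      else (\<lambda>x. B x x ^ s))" for i :: nat
  have q_simps: "q 0 = (\<lambda>x. B x x)" "q (Suc 0) = p1" "q 2 = p2" "q 3 = (\<lambda>x. B x x ^ s)"
    by (simp_all add: q_def)
  have forms: "algebraic_form scale 2 (q 0)" "algebraic_form scale (2 * s) (q 3)"
    using algebraic_form_norm_power[of 1] algebraic_form_norm_power[of s] by (simp_all add: q_simps)
  have "B (e 0) (e 0) \<noteq> 0"
    using nonzero[of 0] assms(5) by (simp add: B_self_eq_0_iff)
  then have "q 0 (e 0) \<noteq> 0" "q 3 (e 0) \<noteq> 0"
    by (simp_all add: q_simps)
  then have "form_degree scale (q 0) = 2" "form_degree scale (q 3) = 2 * s"
    using forms form_degree_eq by metis+
  moreover have "form_degree scale (q (Suc 0)) = d1" "form_degree scale (q 2) = d2"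
    using p1 p2 form_degree_eq unfolding q_simps by metis+
  ultimately have deg: "form_degree scale (q 0) = 2" "form_degree scale (q (Suc 0)) = d1"
    "form_degree scale (q 2) = d2" "form_degree scale (q 3) = 2 * s"
    by simp_all
  have "realizable scale 2 q"
    unfolding realizable_def Let_def assms(4)
  proof (intro conjI)
    show "\<forall>i\<le>2 + 1. \<exists>d. algebraic_form scale d (q i)"
    proof (intro allI impI)
      fix i :: nat assume "i \<le> 2 + 1"
      then consider "i = 0" | "i = 1" | "i = 2" | "i = 3" by linarith
      then show "\<exists>d. algebraic_form scale d (q i)"
        using forms p1(1) p2(1) by cases (auto simp: q_simps)
    qed
    have "\<lceil>of_nat d2 / (2::rat)\<rceil> \<le> int d2"
      by (simp add: ceiling_le_iff)
    then show "\<exists>s. max (int n) (\<lceil>of_nat (form_degree scale (q 2)) / rat_of_nat (form_degree scale (q 0))\<rceil> + 1)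
        \<le> int s \<and> q (2 + 1) = (\<lambda>x. q 0 x ^ s)"
      unfolding deg by (intro exI[of _ s]) (simp add: q_simps s_def)
    show "\<forall>i\<le>2. int (form_degree scale (q (i + 1))) - int (form_degree scale (q i)) > 1"
    proof (intro allI impI)
      fix i :: nat assume "i \<le> 2"
      then consider "i = 0" | "i = 1" | "i = 2" by linarith
      then show "int (form_degree scale (q (i + 1))) - int (form_degree scale (q i)) > 1"
        using d deg(3)[unfolded numeral_2_eq_2] by cases (simp_all add: deg s_def)
    qed
    show "\<exists>v d l. dual_basis scale n v \<and> d > 1 \<and> (\<forall>i<n. l i \<noteq> 0) \<and>
            q 0 = (\<lambda>x. \<Sum>i<n. l i * v i x ^ d)"
    proof (intro exI conjI)
      show "dual_basis scale n (\<lambda>i. B (e i))"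
        by (rule dual_basis)
      show "\<forall>i<n. 1 / B (e i) (e i) \<noteq> 0"
        using nonzero by (simp add: B_self_eq_0_iff)
      show "q 0 = (\<lambda>x. \<Sum>i<n. (1 / B (e i) (e i)) * B (e i) x ^ 2)"
        unfolding q_simps by (rule ext) (rule norm_diagonal)
    qed simp
  qed
  moreover have "\<Gamma> = orthogonal_group scale (q ` {0..2 + 1})"
  proof -
    have "{0..2 + 1::nat} = {0, 1, 2, 3}" by auto
    then have "orthogonal_group scale (q ` {0..2 + 1})
        = {f \<in> carrier (GL scale). \<forall>p\<in>{q 0, q (Suc 0), q 2, q 3}. p \<circ> f = p}"
      by (simp add: orthogonal_group_def)
    also have "\<dots> = {h. isometry h \<and> p1 \<circ> h = p1 \<and> p2 \<circ> h = p2}"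
      by (auto simp: q_simps isometry_iff fun_eq_iff)
    finally show ?thesis by (simp add: stab)
  qed
  ultimately show ?thesis
    using deg(1) unfolding \<Gamma>_def by blast
qed

end
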